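(* Let $a>0$ be a real number, let $n$ be an integer with $n>\lceil a\rceil$, and let $k=\lceil a\rceil-1$. Then, up to isomorphism, $$\mathrm{Ex}(n,\mathrm{gn}\ge a)=\{K_k\oplus E_{n-k}\},$$ and $$\mathrm{ex}(n,\mathrm{gn}\ge a)=\binom{n}{2}-\binom{n-k}{2}.$$
   Context: All graphs are finite, simple and undirected. $K_k$ is the complete graph on $k$ vertices, $E_m$ is the graph on $m$ vertices with no edges, and $G\oplus H$ denotes the join of $G$ and $H$ (the disjoint union together with all edges between $V(G)$ and $V(H)$). Guessing number: for an integer $s\ge 2$ and a graph $G$ with vertices $v_1,\dots,v_n$, a protocol is a family $\mathcal P=\{f_i\}_{i=1}^n$ of functions $f_i:\mathbb Z_s^n\to\mathbb Z_s$ such that $f_i(c)$ depends only on the coordinates of $c$ indexed by the neighbors of $v_i$ (not on $v_i$ itself). View $\mathcal P$ as a map $\mathbb Z_s^n\to\mathbb Z_s^n$, $c\mapsto(f_1(c),\dots,f_n(c))$, and let $\mathrm{fix}(\mathcal P)$ be the number of its fixed points. Then $\mathrm{gn}_s(G)=\mathrm{gn}(G,s)=\log_s\max_{\mathcal P}\mathrm{fix}(\mathcal P)$, and $\mathrm{gn}(G)=\sup_{s\ge 2}\mathrm{gn}(G,s)$. Extremal number: $\mathrm{ex}(n,\mathrm{gn}\ge a)$ is the maximum number of edges over all graphs $G$ on $n$ vertices with $\mathrm{gn}(G)<a$, and $\mathrm{Ex}(n,\mathrm{gn}\ge a)$ is the family of graphs (up to isomorphism) on $n$ vertices with $\mathrm{gn}(G)<a$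 and exactly this number of edges. *)

theory Defs
  imports Complex_Main "HOL-Library.FuncSet"
begin

record 'v ugraph =
  verts :: "'v set"
  edges :: "'v set set"

definition simple_graph :: "'v ugraph \<Rightarrow> bool" where
  "simple_graph G \<longleftrightarrow> finite (verts G) \<and> (\<forall>e\<in>edges G. e \<subseteq> verts G \<and> card e = 2)"

definition neighbors :: "'v ugraph \<Rightarrow> 'v \<Rightarrow> 'v set" where
  "neighbors G v = {u \<in> verts G. {u, v} \<in> edges G}"

definition graph_iso :: "'v ugraph \<Rightarrow> 'w ugraph \<Rightarrow> bool" (infix "\<simeq>\<^sub>g" 50) where
  "G \<simeq>\<^sub>g H \<longleftrightarrow> (\<exists>\<phi>. bij_betw \<phi> (verts G) (verts H) \<and>
     (\<forall>u\<in>verts G. \<forall>v\<in>verts G. {u, v} \<in> edges G \<longleftrightarrow> {\<phi> u, \<phi> v} \<in> edges H))"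

definition complete_graph :: "nat \<Rightarrow> nat ugraph" where
  "complete_graph k = \<lparr>verts = {..<k}, edges = {e. e \<subseteq> {..<k} \<and> card e = 2}\<rparr>"

definition edgeless_graph :: "nat \<Rightarrow> nat ugraph" where
  "edgeless_graph m = \<lparr>verts = {..<m}, edges = {}\<rparr>"

definition graph_join :: "'v ugraph \<Rightarrow> 'w ugraph \<Rightarrow> ('v + 'w) ugraph" where
  "graph_join G H =
     \<lparr>verts = verts G <+> verts H,
      edges = (\<lambda>e. Inl ` e) ` edges G \<union> (\<lambda>e. Inr ` e) ` edges H
              \<union> {{Inl u, Inr v} | u v. u \<in> verts G \<and> v \<in> verts H}\<rparr>"

text \<open>Only the underlying set of the integers modulo \<open>s\<close> matters, so it is taken to be
  \<open>{..<s}\<close>; coordinates are indexed by the vertices themselves.\<close>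

definition configs :: "'v ugraph \<Rightarrow> nat \<Rightarrow> ('v \<Rightarrow> nat) set" where
  "configs G s = verts G \<rightarrow>\<^sub>E {..<s}"

definition protocols :: "'v ugraph \<Rightarrow> nat \<Rightarrow> ('v \<Rightarrow> ('v \<Rightarrow> nat) \<Rightarrow> nat) set" where
  "protocols G s = {f. \<forall>v\<in>verts G. f v \<in> configs G s \<rightarrow> {..<s} \<and>
     (\<forall>c\<in>configs G s. \<forall>c'\<in>configs G s.
        (\<forall>u\<in>neighbors G v. c u = c' u) \<longrightarrow> f v c = f v c')}"

definition protocol_map ::
    "'v ugraph \<Rightarrow> ('v \<Rightarrow> ('v \<Rightarrow> nat) \<Rightarrow> nat) \<Rightarrow> ('v \<Rightarrow> nat) \<Rightarrow> ('v \<Rightarrow> nat)" where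
  "protocol_map G f c = (\<lambda>v\<in>verts G. f v c)"

definition num_fix :: "'v ugraph \<Rightarrow> nat \<Rightarrow> ('v \<Rightarrow> ('v \<Rightarrow> nat) \<Rightarrow> nat) \<Rightarrow> nat" where
  "num_fix G s f = card {c \<in> configs G s. protocol_map G f c = c}"

definition gn_s :: "'v ugraph \<Rightarrow> nat \<Rightarrow> real" where
  "gn_s G s = log (real s) (real (Max (num_fix G s ` protocols G s)))"

definition gn :: "'v ugraph \<Rightarrow> real" where
  "gn G = (SUP s\<in>{2..}. gn_s G s)"

text \<open>The supremum is taken in the reals, so it is meaningful only because the family is
  bounded.\<close>

lemma bdd_above_gn_s:
  assumes "simple_graph G"
  shows "bdd_above (gn_s G ` {2..})"
proof (rule bdd_aboveI2)
  fix s :: nat assume "s \<in> {2..}"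
  then have s: "s \<ge> 2" by simp
  have fin: "finite (verts G)" using assms by (simp add: simple_graph_def)
  have cfin: "finite (configs G s)"
    unfolding configs_def by (rule finite_PiE) (use fin in auto)
  have ccard: "card (configs G s) = s ^ card (verts G)"
    unfolding configs_def using fin by (simp add: card_PiE)
  have le: "num_fix G s f \<le> s ^ card (verts G)" for f
    unfolding num_fix_def ccard[symmetric] by (rule card_mono) (use cfin in auto)
  have pfin: "finite (num_fix G s ` protocols G s)"
    by (rule finite_subset[of _ "{..s ^ card (verts G)}"]) (use le in auto)
  define c0 where "c0 = (\<lambda>v\<in>verts G. 0::nat)"
  have p0: "(\<lambda>v c. 0) \<in> protocols G s" using s by (auto simp: protocols_def)
  have "c0 \<in> {c \<in> configs G s. protocol_map G (\<lambda>v c. 0) c = c}"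
    using s by (auto simp: c0_def configs_def protocol_map_def)
  then have "num_fix G s (\<lambda>v c. 0) > 0"
    unfolding num_fix_def using cfin by (subst card_gt_0_iff) auto
  then have pos: "Max (num_fix G s ` protocols G s) > 0"
    using pfin p0 by (subst Max_gr_iff) auto
  have "Max (num_fix G s ` protocols G s) \<le> s ^ card (verts G)"
    using pfin p0 le by (subst Max_le_iff) auto
  then have "real (Max (num_fix G s ` protocols G s)) \<le> real s ^ card (verts G)"
    by (metis of_nat_le_iff of_nat_power)
  then have "gn_s G s \<le> log (real s) (real s ^ card (verts G))"
    unfolding gn_s_def using pos s by (intro log_mono) auto
  also have "\<dots> = real (card (verts G))" using s by (simp add: log_nat_power)
  finally show "gn_s G s \<le> real (card (verts G))" .
qed

text \<open>Every finite graph is isomorphic to one whose vertices are natural numbers, so it suffices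
  to range over those. \<open>Ex_gn n a\<close> contains all isomorphic copies of each of its members.
  The maximum in \<open>ex_gn\<close> is over a finite set, non-empty for \<open>a > 0\<close> because an edgeless graph has
  guessing number \<open>0\<close>.\<close>

definition gn_free_graphs :: "nat \<Rightarrow> real \<Rightarrow> nat ugraph set" where
  "gn_free_graphs n a = {G. simple_graph G \<and> card (verts G) = n \<and> gn G < a}"

definition ex_gn :: "nat \<Rightarrow> real \<Rightarrow> nat" where
  "ex_gn n a = Max ((\<lambda>G. card (edges G)) ` gn_free_graphs n a)"

definition Ex_gn :: "nat \<Rightarrow> real \<Rightarrow> nat ugraph set" where
  "Ex_gn n a = {G \<in> gn_free_graphs n a. card (edges G) = ex_gn n a}"

end

theory Submission
  imports Defs
begin

text \<open>A graph that plays \<open>parity of the clique is prescribed\<close> on each of \<open>r\<close> disjoint cliques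
  covering its vertices has guessing number at least \<open>n - r\<close>, and a graph with an independent set
  \<open>I\<close> has guessing number at most \<open>n - card I\<close>. Clique covers are colourings of the complement, and
  a graph with at most \<open>m choose 2\<close> edges is \<open>(m - 1)\<close>-colourable unless its edges form exactly
  one \<open>m\<close>-clique: a minimal non-\<open>(m - 1)\<close>-colourable vertex set \<open>W\<close> induces minimum degree at
  least \<open>m - 1\<close>, hence at least \<open>card W * (m - 1) / 2\<close> edges. Apply this with \<open>m = n - k\<close> to the
  complement.\<close>

section \<open>Colouring graphs with few edges\<close>

text \<open>\<open>E\<close> may contain edges leaving \<open>W\<close>; only those inside
  \<open>W\<close> constrain \<open>c\<close>. The same edge set can thus be kept while the vertex
  set shrinks.\<close>

definition proper_coloring :: "'v set set \<Rightarrow> 'v set \<Rightarrow> nat \<Rightarrow> ('v \<Rightarrow> nat) \<Rightarrow> bool" where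
  "proper_coloring E W r c \<longleftrightarrow>
     c ` W \<subseteq> {..<r} \<and> (\<forall>u\<in>W. \<forall>v\<in>W. u \<noteq> v \<longrightarrow> {u, v} \<in> E \<longrightarrow> c u \<noteq> c v)"

text \<open>Greedy step: fewer than \<open>r\<close> neighbours of \<open>w\<close> use fewer than
  \<open>r\<close> colours, so some colour is free for \<open>w\<close>.\<close>

lemma proper_coloring_extend:
  assumes "finite W" "w \<in> W" "proper_coloring E (W - {w}) r c"
    and "card {u \<in> W - {w}. {u, w} \<in> E} < r"
  shows "\<exists>c'. proper_coloring E W r c'"
proof -
  define N where "N = {u \<in> W - {w}. {u, w} \<in> E}"
  have "card (c ` N) < r"
    using assms card_image_le[of N c] by (simp add: N_def)
  then have "\<not> {..<r} \<subseteq> c ` N"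
    using card_mono[of "c ` N" "{..<r}"] assms(1) by (auto simp: N_def)
  then obtain i where i: "i < r" "i \<notin> c ` N" by auto
  have sym: "{w, v} = {v, w}" for v by auto
  have "proper_coloring E W r (c(w := i))"
    unfolding proper_coloring_def
  proof (intro conjI ballI impI)
    show "(c(w := i)) ` W \<subseteq> {..<r}"
      using assms(3) i(1) by (auto simp: proper_coloring_def)
  next
    fix u v assume uv: "u \<in> W" "v \<in> W" "u \<noteq> v" "{u, v} \<in> E"
    consider "u = w" | "v = w" | "u \<noteq> w" "v \<noteq> w" by blast
    then show "(c(w := i)) u \<noteq> (c(w := i)) v"
    proof cases
      case 1
      then have "v \<in> N" using uv by (auto simp: N_def sym)
      then show ?thesis using i 1 uv by auto
    next
      case 2
      then have "u \<in> N" using uv by (auto simp: N_def)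
      then show ?thesis using i 2 uv by auto
    next
      case 3
      then show ?thesis using assms(3) uv by (auto simp: proper_coloring_def)
    qed
  qed
  then show ?thesis by blast
qed

text \<open>The handshake lemma, by double counting incident pairs of a vertex and an edge. The map
  sending \<open>u\<close> to \<open>{u, w}\<close> turns neighbours of \<open>w\<close> into edges
  through \<open>w\<close>.\<close>

lemma sum_degrees:
  assumes "finite W" and E: "\<And>e. e \<in> E \<Longrightarrow> e \<subseteq> W \<and> card e = 2"
  shows "(\<Sum>w\<in>W. card {u \<in> W - {w}. {u, w} \<in> E}) = 2 * card E"
proof -
  have finE: "finite E"
    by (rule finite_subset[of _ "Pow W"]) (use assms in auto)
  have deg: "card {u \<in> W - {w}. {u, w} \<in> E} = card {e \<in> E. w \<in> e}" if "w \<in> W" for w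
  proof (rule bij_betw_same_card[of "\<lambda>u. {u, w}"], unfold bij_betw_def, intro conjI)
    show "inj_on (\<lambda>u. {u, w}) {u \<in> W - {w}. {u, w} \<in> E}"
      by (auto simp: inj_on_def doubleton_eq_iff)
    show "(\<lambda>u. {u, w}) ` {u \<in> W - {w}. {u, w} \<in> E} = {e \<in> E. w \<in> e}"
    proof (intro equalityI subsetI)
      fix e assume e: "e \<in> {e \<in> E. w \<in> e}"
      then have "card e = 2" using E by blast
      then obtain x y where "e = {x, y}" "x \<noteq> y" by (auto simp: card_2_iff)
      then obtain u where "e = {u, w}" "u \<noteq> w" using e by (auto simp: insert_commute)
      then show "e \<in> (\<lambda>u. {u, w}) ` {u \<in> W - {w}. {u, w} \<in> E}" using e E by auto
    qed auto
  qed
  have "(\<Sum>w\<in>W. card {e \<in> E. w \<in> e}) = 2 * card E"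
  proof (rule sum_multicount)
    show "\<forall>e\<in>E. card {w \<in> W. w \<in> e} = 2"
    proof
      fix e assume "e \<in> E"
      then have "{w \<in> W. w \<in> e} = e" "card e = 2" using E by auto
      then show "card {w \<in> W. w \<in> e} = 2" by simp
    qed
  qed (use assms(1) finE in auto)
  then show ?thesis using deg by simp
qed

text \<open>In a smallest non-colourable set \<open>W\<close> every degree is at least
  \<open>m - 1\<close>, since otherwise a colouring of \<open>W - {w}\<close> would extend to
  \<open>w\<close>. Hence \<open>card W\<close> is at least \<open>m\<close>, and counting edges
  inside \<open>W\<close> leaves no slack: \<open>W\<close> has exactly \<open>m\<close> vertices,
  all pairs in it are edges, and there are no other edges.\<close>

lemma few_edges_not_colorable:
  assumes fin: "finite V" and E: "\<And>e. e \<in> E \<Longrightarrow> e \<subseteq> V \<and> card e = 2"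
    and few: "card E \<le> m choose 2" and m: "m \<ge> 2"
    and nocol: "\<nexists>c. proper_coloring E V (m - 1) c"
  obtains W where "W \<subseteq> V" "card W = m" "E = {e. e \<subseteq> W \<and> card e = 2}"
proof -
  define P where "P W \<longleftrightarrow> W \<subseteq> V \<and> (\<nexists>c. proper_coloring E W (m - 1) c)" for W
  have "P V" using nocol by (simp add: P_def)
  then obtain W where W: "P W" and min: "\<And>U. P U \<Longrightarrow> card W \<le> card U"
    using ex_has_least_nat[of P V card] by blast
  have finW: "finite W" using W fin by (auto simp: P_def intro: finite_subset)
  have deg: "card {u \<in> W - {w}. {u, w} \<in> E} \<ge> m - 1" if w: "w \<in> W" for w
  proof (rule ccontr)
    assume "\<not> ?thesis"
    moreover have "\<not> P (W - {w})"
      using min[of "W - {w}"] card_Diff1_less[OF finW w] by linarith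
    then obtain c where "proper_coloring E (W - {w}) (m - 1) c"
      using W by (auto simp: P_def)
    ultimately show False
      using proper_coloring_extend[OF finW w] W by (auto simp: P_def)
  qed
  \<comment> \<open>The empty set is coloured by any function, whatever the number of
    colours.\<close>
  have "W \<noteq> {}" using W by (auto simp: P_def proper_coloring_def)
  then obtain w where w: "w \<in> W" by blast
  have "m - 1 \<le> card (W - {w})"
    using deg[OF w] card_mono[of "W - {w}" "{u \<in> W - {w}. {u, w} \<in> E}"] finW by fastforce
  then have cW: "m \<le> card W" using w finW m by (simp add: card_Diff_singleton)
  define EW where "EW = {e \<in> E. e \<subseteq> W}"
  have finE: "finite E"
    by (rule finite_subset[of _ "Pow V"]) (use assms in auto)
  have "card W * (m - 1) = (\<Sum>w\<in>W. m - 1)" by simp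
  also have "\<dots> \<le> (\<Sum>w\<in>W. card {u \<in> W - {w}. {u, w} \<in> E})"
    by (rule sum_mono) (rule deg)
  \<comment> \<open>Degrees within \<open>W\<close> see only edges inside \<open>W\<close>, so the
    handshake lemma can be applied to \<open>EW\<close>.\<close>
  also have "\<dots> = (\<Sum>w\<in>W. card {u \<in> W - {w}. {u, w} \<in> EW})"
    by (intro sum.cong refl arg_cong[of _ _ card]) (auto simp: EW_def)
  also have "\<dots> = 2 * card EW"
    by (rule sum_degrees) (use finW E in \<open>auto simp: EW_def\<close>)
  finally have 1: "card W * (m - 1) \<le> 2 * card EW" .
  have sub: "card EW \<le> card E" by (rule card_mono) (use finE in \<open>auto simp: EW_def\<close>)
  have ch: "2 * (m choose 2) = m * (m - 1)"
    by (cases m) (simp_all add: choose_two)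
  have "card W * (m - 1) \<le> m * (m - 1)" using 1 sub few ch by linarith
  \<comment> \<open>The factor \<open>m - 1\<close> is positive because \<open>m\<close> is at least
    2, so it cancels.\<close>
  then have eqW: "card W = m" using cW m by simp
  \<comment> \<open>With \<open>card W = m\<close> the chain from \<open>m * (m - 1)\<close> through
    \<open>2 * card EW\<close> and \<open>2 * card E\<close> back to \<open>m * (m - 1)\<close>
    consists of equalities.\<close>
  then have "card E = m choose 2" "card EW = card E"
    using 1 sub few ch by simp_all
  then have EW: "EW = E" using finE by (intro card_subset_eq) (auto simp: EW_def)
  have "E = {e. e \<subseteq> W \<and> card e = 2}"
  proof (rule card_subset_eq)
    show "finite {e. e \<subseteq> W \<and> card e = 2}" using finW by simp
    show "E \<subseteq> {e. e \<subseteq> W \<and> card e = 2}" using EW E by (auto simp: EW_def)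
    show "card E = card {e. e \<subseteq> W \<and> card e = 2}"
      using n_subsets[OF finW, of 2] eqW \<open>card E = m choose 2\<close> by simp
  qed
  then show ?thesis using that W eqW unfolding P_def by blast
qed

section \<open>Bounds on the guessing number\<close>

lemma finite_configs: "finite (verts G) \<Longrightarrow> finite (configs G s)"
  unfolding configs_def by (rule finite_PiE) auto

lemma card_configs: "finite (verts G) \<Longrightarrow> card (configs G s) = s ^ card (verts G)"
  unfolding configs_def by (simp add: card_PiE)

text \<open>\<open>protocols G s\<close> itself is infinite, since a protocol is unconstrained
  outside \<open>configs G s\<close>. The fixed-point counts are bounded by the number of
  configurations, which makes \<open>Max\<close> meaningful.\<close>

lemma finite_num_fix_protocols:
  assumes "finite (verts G)"
  shows "finite (num_fix G s ` protocols G s)"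
proof (rule finite_subset[of _ "{..card (configs G s)}"])
  show "num_fix G s ` protocols G s \<subseteq> {..card (configs G s)}"
    unfolding num_fix_def using finite_configs[OF assms] by (auto intro!: card_mono)
qed simp

text \<open>The zero protocol fixes the zero configuration. Positivity is what monotonicity of the
  logarithm requires.\<close>

lemma Max_num_fix_pos:
  assumes "finite (verts G)" "s \<ge> 1"
  shows "Max (num_fix G s ` protocols G s) > 0"
proof -
  have p0: "(\<lambda>v c. 0) \<in> protocols G s" using assms(2) by (auto simp: protocols_def)
  have "(\<lambda>v\<in>verts G. 0) \<in> {c \<in> configs G s. protocol_map G (\<lambda>v c. 0) c = c}"
    using assms(2) by (auto simp: configs_def protocol_map_def)
  then have "num_fix G s (\<lambda>v c. 0) > 0"
    unfolding num_fix_def using finite_configs[OF assms(1)] by (subst card_gt_0_iff) auto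
  then show ?thesis
    using finite_num_fix_protocols[OF assms(1)] p0 by (subst Max_gr_iff) auto
qed

text \<open>A vertex of \<open>I\<close> sees only vertices outside \<open>I\<close>, so a fixed
  point is determined by its restriction to \<open>verts G - I\<close>. This leaves at most
  \<open>s ^ card (verts G - I)\<close> fixed points for every \<open>s\<close>.\<close>

lemma gn_le_card_diff_independent:
  assumes G: "simple_graph G" and I: "I \<subseteq> verts G"
    and indep: "\<And>u v. u \<in> I \<Longrightarrow> v \<in> I \<Longrightarrow> {u, v} \<notin> edges G"
  shows "gn G \<le> real (card (verts G - I))"
  unfolding gn_def
proof (rule cSUP_least)
  fix s :: nat assume "s \<in> {2..}"
  then have s: "s \<ge> 2" by simp
  have fin: "finite (verts G)" using G by (simp add: simple_graph_def)
  let ?m = "card (verts G - I)"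
  have "num_fix G s f \<le> s ^ ?m" if f: "f \<in> protocols G s" for f
  proof -
    let ?F = "{c \<in> configs G s. protocol_map G f c = c}"
    let ?R = "\<lambda>c. restrict c (verts G - I)"
    have "inj_on ?R ?F"
    proof (rule inj_onI)
      fix c d assume c: "c \<in> ?F" and d: "d \<in> ?F" and eq: "?R c = ?R d"
      have out: "c v = d v" if "v \<in> verts G - I" for v
        using fun_cong[OF eq, of v] that by simp
      have fx: "c v = f v c" "d v = f v d" if "v \<in> verts G" for v
        using c d that by (auto simp: protocol_map_def dest: fun_cong[of _ _ v])
      have "c v = d v" if v: "v \<in> I" for v
      proof -
        have "\<forall>u\<in>neighbors G v. c u = d u"
          using out indep[OF _ v] by (auto simp: neighbors_def)
        moreover have "c \<in> configs G s" "d \<in> configs G s" "v \<in> verts G"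
          using c d v I by auto
        ultimately have "f v c = f v d"
          using f unfolding protocols_def by blast
        then show ?thesis using fx[OF \<open>v \<in> verts G\<close>] by simp
      qed
      with out have "\<forall>v\<in>verts G. c v = d v" by auto
      \<comment> \<open>Configurations are extensional, so agreement on the vertices is
        equality.\<close>
      then show "c = d" using c d unfolding configs_def
        by (intro PiE_ext[of c "verts G" _ d]) auto
    qed
    moreover have "?R ` ?F \<subseteq> (verts G - I) \<rightarrow>\<^sub>E {..<s}"
      by (auto simp: configs_def)
    moreover have "finite ((verts G - I) \<rightarrow>\<^sub>E {..<s})"
      using fin by (intro finite_PiE) auto
    ultimately have "card ?F \<le> card ((verts G - I) \<rightarrow>\<^sub>E {..<s})"
      by (rule card_inj_on_le)
    also have "\<dots> = s ^ ?m" using fin by (simp add: card_PiE)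
    finally show ?thesis by (simp add: num_fix_def)
  qed
  moreover have "protocols G s \<noteq> {}" using s by (auto simp: protocols_def intro: exI[of _ "\<lambda>_ _. 0"])
  ultimately have "Max (num_fix G s ` protocols G s) \<le> s ^ ?m"
    using finite_num_fix_protocols[OF fin] by (subst Max_le_iff) auto
  then have "real (Max (num_fix G s ` protocols G s)) \<le> real s ^ ?m"
    by (metis of_nat_le_iff of_nat_power)
  then have "gn_s G s \<le> log (real s) (real s ^ ?m)"
    unfolding gn_s_def using Max_num_fix_pos[OF fin, of s] s by (intro log_mono) auto
  also have "\<dots> = real ?m" using s by (simp add: log_nat_power)
  finally show "gn_s G s \<le> real ?m" .
qed simp

text \<open>The parities to prescribe on the cliques are chosen by pigeonhole.\<close>

lemma gn_ge_clique_cover: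
  assumes G: "simple_graph G"
    and col: "c ` verts G \<subseteq> {..<r}"
    and clique: "\<And>u v. u \<in> verts G \<Longrightarrow> v \<in> verts G \<Longrightarrow> u \<noteq> v \<Longrightarrow> c u = c v \<Longrightarrow> {u, v} \<in> edges G"
    and r: "r \<le> card (verts G)"
  shows "gn G \<ge> real (card (verts G)) - real r"
proof -
  have fin: "finite (verts G)" using G by (simp add: simple_graph_def)
  let ?n = "card (verts G)"
  define cls where "cls i = {v \<in> verts G. c v = i}" for i
  have fcls: "finite (cls i)" for i using fin by (simp add: cls_def)
  \<comment> \<open>The alphabet size is 2; \<open>par x\<close> records the parity of
    \<open>x\<close> on each of the \<open>r\<close> colour classes, which are the cliques.\<close>
  define par where "par x = (\<lambda>i\<in>{..<r}. sum x (cls i) mod 2)" for x :: "'a \<Rightarrow> nat"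
  let ?C = "configs G 2" and ?Q = "{..<r} \<rightarrow>\<^sub>E {..<2::nat}"
  have finC: "finite ?C" by (rule finite_configs[OF fin])
  have finQ: "finite ?Q" by (intro finite_PiE) auto
  have parQ: "par x \<in> ?Q" for x by (auto simp: par_def)
  \<comment> \<open>The \<open>2 ^ ?n\<close> configurations are distributed over
    \<open>2 ^ r\<close> parity vectors.\<close>
  have "\<exists>q\<in>?Q. 2 ^ (?n - r) \<le> card {x \<in> ?C. par x = q}"
  proof (rule ccontr)
    assume "\<not> ?thesis"
    then have less: "card {x \<in> ?C. par x = q} < 2 ^ (?n - r)" if "q \<in> ?Q" for q
      using that by auto
    have "2 ^ ?n = card ?C" using card_configs[OF fin] by simp
    also have "\<dots> = card (\<Union>q\<in>?Q. {x \<in> ?C. par x = q})"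
      using parQ by (intro arg_cong[of _ _ card]) auto
    also have "\<dots> = (\<Sum>q\<in>?Q. card {x \<in> ?C. par x = q})"
      by (rule card_UN_disjoint) (use finQ finC in auto)
    also have "\<dots> < (\<Sum>q\<in>?Q. 2 ^ (?n - r))"
      by (rule sum_strict_mono) (use finQ less parQ in auto)
    also have "\<dots> = 2 ^ r * 2 ^ (?n - r)" by (simp add: card_PiE)
    also have "\<dots> = 2 ^ ?n" using r by (simp flip: power_add)
    finally show False by simp
  qed
  then obtain q where q: "q \<in> ?Q" "2 ^ (?n - r) \<le> card {x \<in> ?C. par x = q}" by blast
  \<comment> \<open>Each vertex guesses the value that gives its clique the parity prescribed by
    \<open>q\<close>. Modulo 2, adding the sum of the others is the same as subtracting it.\<close>
  define f where "f v x = (q (c v) + sum x (cls (c v) - {v})) mod 2" for v and x :: "'a \<Rightarrow> nat"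
  have f: "f \<in> protocols G 2"
  proof -
    have "f v x = f v y" if "v \<in> verts G" "\<forall>u\<in>neighbors G v. x u = y u" for v x y
    proof -
      \<comment> \<open>The other members of the class are neighbours of \<open>v\<close>, so
        \<open>v\<close> sees every summand.\<close>
      have "sum x (cls (c v) - {v}) = sum y (cls (c v) - {v})"
        by (rule sum.cong) (use that clique[of _ v] in \<open>auto simp: cls_def neighbors_def\<close>)
      then show ?thesis by (simp add: f_def)
    qed
    then show ?thesis by (auto simp: protocols_def f_def)
  qed
  have "{x \<in> ?C. par x = q} \<subseteq> {x \<in> ?C. protocol_map G f x = x}"
  proof safe
    fix x assume x: "x \<in> ?C" and q: "q = par x"
    have "f v x = x v" if v: "v \<in> verts G" for v
    proof -
      have "x v < 2" using x v by (auto simp: configs_def)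
      moreover have "sum x (cls (c v)) = x v + sum x (cls (c v) - {v})"
        using v fcls by (intro sum.remove) (auto simp: cls_def)
      moreover have "par x (c v) = sum x (cls (c v)) mod 2"
        using v col by (auto simp: par_def)
      ultimately show ?thesis unfolding f_def q by presburger
    qed
    then show "protocol_map G f x = x"
      using x by (auto simp: protocol_map_def configs_def PiE_def extensional_def)
  qed
  then have "card {x \<in> ?C. par x = q} \<le> num_fix G 2 f"
    unfolding num_fix_def by (rule card_mono[rotated]) (use finC in auto)
  also have "\<dots> \<le> Max (num_fix G 2 ` protocols G 2)"
    using finite_num_fix_protocols[OF fin] f by (intro Max_ge) auto
  finally have "2 ^ (?n - r) \<le> Max (num_fix G 2 ` protocols G 2)"
    using q(2) by linarith
  then have "2 ^ (?n - r) \<le> real (Max (num_fix G 2 ` protocols G 2))"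
    by (metis of_nat_le_iff of_nat_power of_nat_numeral)
  then have "log 2 (2 ^ (?n - r)) \<le> gn_s G 2"
    unfolding gn_s_def of_nat_numeral by (intro log_mono) auto
  also have "\<dots> \<le> gn G"
    unfolding gn_def by (rule cSUP_upper) (use bdd_above_gn_s[OF G] in auto)
  finally show ?thesis using r by (simp add: log_nat_power of_nat_diff)
qed

section \<open>The extremal graphs\<close>

text \<open>Describes the join intrinsically: the non-adjacent pairs are exactly the pairs inside a
  set \<open>I\<close> of \<open>n - k\<close> vertices, namely those mapped to the edgeless side.
  Edge counts and independence can then be read off without any isomorphism.\<close>

lemma iso_join_complete_edgeless_iff:
  assumes G: "simple_graph G" and kn: "k \<le> n"
  shows "G \<simeq>\<^sub>g graph_join (complete_graph k) (edgeless_graph (n - k)) \<longleftrightarrow>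
    card (verts G) = n \<and>
    (\<exists>I\<subseteq>verts G. card I = n - k \<and> edges G = {e. e \<subseteq> verts G \<and> card e = 2 \<and> \<not> e \<subseteq> I})"
    (is "_ \<simeq>\<^sub>g ?J \<longleftrightarrow> ?R")
proof -
  have finG: "finite (verts G)" using G by (simp add: simple_graph_def)
  have vJ: "verts ?J = {..<k} <+> {..<n - k}"
    by (simp add: graph_join_def complete_graph_def edgeless_graph_def)
  have cJ: "card (verts ?J) = n" using kn by (simp add: vJ card_Plus)
  \<comment> \<open>Adjacency in the join fails only for equal vertices and for two vertices of the
    edgeless side. The case of two left vertices needs care: membership is transferred along the
    injective lifting of edges by \<open>Inl\<close>.\<close>
  have eJ: "{x, y} \<in> edges ?J \<longleftrightarrow> x \<noteq> y \<and> \<not> (x \<in> range Inr \<and> y \<in> range Inr)"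
    if "x \<in> verts ?J" "y \<in> verts ?J" for x y
  proof (cases x; cases y)
    fix i j assume "x = Inl i" "y = Inl j"
    moreover have "{Inl i, Inl j} \<in> (`) Inl ` {e. e \<subseteq> {..<k} \<and> card e = 2} \<longleftrightarrow>
        {i, j} \<in> {e. e \<subseteq> {..<k} \<and> card e = 2}"
      using inj_image_mem_iff[of "(`) Inl" "{i, j}" "{e. e \<subseteq> {..<k} \<and> card e = 2}"]
      by (simp add: inj_def inj_image_eq_iff)
    then have "{Inl i, Inl j} \<in> (`) Inl ` {e. e \<subseteq> {..<k} \<and> card e = 2} \<longleftrightarrow>
        i < k \<and> j < k \<and> i \<noteq> j"
      by (cases "i = j") auto
    moreover have "(Inl i :: nat + nat) \<notin> range Inr" by blast
    moreover have "i < k" "j < k" using that \<open>x = Inl i\<close> \<open>y = Inl j\<close> by (auto simp: vJ)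
    ultimately show ?thesis
      by (simp add: graph_join_def complete_graph_def edgeless_graph_def doubleton_eq_iff)
  qed (use that in \<open>auto simp: graph_join_def complete_graph_def edgeless_graph_def
        doubleton_eq_iff image_iff\<close>)
  show ?thesis
  proof
    assume "G \<simeq>\<^sub>g ?J"
    then obtain \<phi> where bij: "bij_betw \<phi> (verts G) (verts ?J)"
      and iso: "\<And>u v. u \<in> verts G \<Longrightarrow> v \<in> verts G \<Longrightarrow>
          {u, v} \<in> edges G \<longleftrightarrow> {\<phi> u, \<phi> v} \<in> edges ?J"
      unfolding graph_iso_def by blast
    define I where "I = {v \<in> verts G. \<phi> v \<in> range Inr}"
    have "bij_betw \<phi> I (Inr ` {..<n - k})"
    proof -
      have "\<phi> ` I = \<phi> ` verts G \<inter> range Inr" unfolding I_def by blast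
      also have "\<dots> = verts ?J \<inter> range Inr" using bij by (simp add: bij_betw_def)
      also have "\<dots> = Inr ` {..<n - k}" by (auto simp: vJ)
      finally show ?thesis using bij by (auto simp: bij_betw_def I_def intro: inj_on_subset)
    qed
    then have cI: "card I = n - k" by (simp add: bij_betw_same_card card_image)
    have inG: "\<phi> v \<in> verts ?J" if "v \<in> verts G" for v
      using bij that by (auto simp: bij_betw_def)
    have inj: "\<phi> u = \<phi> v \<longleftrightarrow> u = v" if "u \<in> verts G" "v \<in> verts G" for u v
      using bij that by (auto simp: bij_betw_def inj_on_def)
    have pair: "{u, v} \<in> edges G \<longleftrightarrow> u \<noteq> v \<and> \<not> {u, v} \<subseteq> I"
      if "u \<in> verts G" "v \<in> verts G" for u v
      using that by (simp add: iso eJ inG inj I_def)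
    have "edges G = {e. e \<subseteq> verts G \<and> card e = 2 \<and> \<not> e \<subseteq> I}"
    proof (intro set_eqI)
      fix e
      show "e \<in> edges G \<longleftrightarrow> e \<in> {e. e \<subseteq> verts G \<and> card e = 2 \<and> \<not> e \<subseteq> I}"
      proof (cases "e \<subseteq> verts G \<and> card e = 2")
        case True
        then obtain u v where "e = {u, v}" "u \<noteq> v" by (auto simp: card_2_iff)
        then show ?thesis using True pair[of u v] by auto
      next
        case False
        then show ?thesis using G by (auto simp: simple_graph_def)
      qed
    qed
    moreover have "card (verts G) = n" using bij cJ by (simp add: bij_betw_same_card)
    moreover have "I \<subseteq> verts G" by (auto simp: I_def)
    ultimately show ?R using cI by blast
  next
    assume ?R
    then obtain I where n: "card (verts G) = n" and I: "I \<subseteq> verts G" "card I = n - k"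
      and E: "edges G = {e. e \<subseteq> verts G \<and> card e = 2 \<and> \<not> e \<subseteq> I}" by blast
    have finI: "finite I" using I finG by (auto intro: finite_subset)
    have "card (verts G - I) = k" using I n finI kn by (simp add: card_Diff_subset)
    then obtain g where g: "bij_betw g (verts G - I) {..<k}"
      using finite_same_card_bij[of "verts G - I" "{..<k}"] finG by auto
    obtain h where h: "bij_betw h I {..<n - k}"
      using finite_same_card_bij[of I "{..<n - k}"] finI I by auto
    \<comment> \<open>Any bijections \<open>g\<close> and \<open>h\<close> on the two parts serve,
      since adjacency depends only on distinctness and on membership in \<open>I\<close>.\<close>
    define \<phi> where "\<phi> v = (if v \<in> I then Inr (h v) else Inl (g v))" for v
    have "bij_betw \<phi> (verts G) (verts ?J)"
    proof -
      have inj: "inj_on \<phi> (verts G)"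
        using g h by (auto simp: \<phi>_def inj_on_def bij_betw_def)
      have "\<phi> ` verts G = \<phi> ` (verts G - I) \<union> \<phi> ` I" using I by blast
      also have "\<phi> ` (verts G - I) = Inl ` (g ` (verts G - I))"
        by (auto simp: \<phi>_def image_iff)
      also have "\<phi> ` I = Inr ` (h ` I)" by (auto simp: \<phi>_def image_iff)
      finally have "\<phi> ` verts G = verts ?J"
        using g h by (simp add: bij_betw_def vJ Plus_def)
      with inj show ?thesis by (simp add: bij_betw_def)
    qed
    moreover have "{u, v} \<in> edges G \<longleftrightarrow> {\<phi> u, \<phi> v} \<in> edges ?J"
      if uv: "u \<in> verts G" "v \<in> verts G" for u v
    proof -
      have "\<phi> u \<in> verts ?J" "\<phi> v \<in> verts ?J" "\<phi> u = \<phi> v \<longleftrightarrow> u = v"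
        using \<open>bij_betw \<phi> _ _\<close> uv by (auto simp: bij_betw_def inj_on_def)
      moreover have "\<phi> w \<in> range Inr \<longleftrightarrow> w \<in> I" for w by (auto simp: \<phi>_def)
      ultimately have "{\<phi> u, \<phi> v} \<in> edges ?J \<longleftrightarrow> u \<noteq> v \<and> \<not> {u, v} \<subseteq> I"
        by (simp add: eJ)
      then show ?thesis using uv by (auto simp: E card_2_iff)
    qed
    ultimately show "G \<simeq>\<^sub>g ?J" unfolding graph_iso_def by blast
  qed
qed

text \<open>Edges and non-edges partition the pairs of vertices. The additive form avoids truncated
  subtraction.\<close>

lemma card_edges_complement:
  assumes "simple_graph G"
  shows "card {e. e \<subseteq> verts G \<and> card e = 2 \<and> e \<notin> edges G} + card (edges G) = card (verts G) choose 2"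
proof -
  have fin: "finite (verts G)" using assms by (simp add: simple_graph_def)
  let ?P = "{e. e \<subseteq> verts G \<and> card e = 2}"
  have finP: "finite ?P" using fin by simp
  have sub: "edges G \<subseteq> ?P" using assms by (auto simp: simple_graph_def)
  have "{e. e \<subseteq> verts G \<and> card e = 2 \<and> e \<notin> edges G} = ?P - edges G" by auto
  moreover have "card (?P - edges G) + card (edges G) = card ?P"
    using card_Diff_subset[OF finite_subset[OF sub finP] sub] card_mono[OF finP sub] by linarith
  ultimately show ?thesis using n_subsets[OF fin, of 2] by simp
qed

text \<open>The non-edges \<open>?N\<close> number at most \<open>(n - k) choose 2\<close>. A
  colouring of them with \<open>n - k - 1\<close> colours would cover \<open>G\<close> by that many
  cliques and force a guessing number of at least \<open>k + 1\<close>. So the non-edges are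
  precisely the pairs of some \<open>W\<close> with \<open>n - k\<close> vertices.\<close>

lemma gn_lt_many_edges:
  assumes G: "simple_graph G" and n: "card (verts G) = n" and kn: "k + 2 \<le> n"
    and gn: "gn G < real k + 1"
    and many: "card (edges G) \<ge> (n choose 2) - ((n - k) choose 2)"
  shows "G \<simeq>\<^sub>g graph_join (complete_graph k) (edgeless_graph (n - k))"
proof -
  let ?N = "{e. e \<subseteq> verts G \<and> card e = 2 \<and> e \<notin> edges G}"
  have fin: "finite (verts G)" using G by (simp add: simple_graph_def)
  have "card ?N \<le> (n - k) choose 2"
    using card_edges_complement[OF G, unfolded n] many by linarith
  moreover have "\<nexists>c. proper_coloring ?N (verts G) (n - k - 1) c"
  proof
    assume "\<exists>c. proper_coloring ?N (verts G) (n - k - 1) c"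
    then obtain c where col: "proper_coloring ?N (verts G) (n - k - 1) c" ..
    then have "c ` verts G \<subseteq> {..<n - k - 1}" unfolding proper_coloring_def by (rule conjunct1)
    then have "gn G \<ge> real (card (verts G)) - real (n - k - 1)"
    proof (rule gn_ge_clique_cover[OF G])
      fix u v assume uv: "u \<in> verts G" "v \<in> verts G" "u \<noteq> v" "c u = c v"
      then have "{u, v} \<notin> ?N"
        using conjunct2[OF col[unfolded proper_coloring_def], rule_format, OF uv(1-3)]
          uv(4) by blast
      then show "{u, v} \<in> edges G" using uv by auto
    qed (use n in simp)
    \<comment> \<open>Here \<open>n - (n - k - 1)\<close> equals \<open>k + 1\<close>, against the
      strict bound on \<open>gn G\<close>.\<close>
    then show False using gn n kn by (simp add: of_nat_diff)
  qed
  moreover have "n - k \<ge> 2" using kn by simp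
  ultimately obtain W where W: "W \<subseteq> verts G" "card W = n - k" "?N = {e. e \<subseteq> W \<and> card e = 2}"
    using few_edges_not_colorable[OF fin, of ?N "n - k"] by blast
  have "edges G = {e. e \<subseteq> verts G \<and> card e = 2 \<and> \<not> e \<subseteq> W}"
    using W(1,3) G unfolding simple_graph_def by blast
  moreover have "k \<le> n" using kn by simp
  ultimately show ?thesis using W(1,2) n iso_join_complete_edgeless_iff[OF G, of k n] by blast
qed

text \<open>All three conclusions come from one set \<open>I\<close> of \<open>n - k\<close>
  vertices: it is independent, its pairs are the only non-edges, and \<open>k\<close> vertices lie
  outside it.\<close>

lemma
  assumes G: "simple_graph G" and kn: "k \<le> n"
    and iso: "G \<simeq>\<^sub>g graph_join (complete_graph k) (edgeless_graph (n - k))"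
  shows card_verts_iso_join: "card (verts G) = n"
    and card_edges_iso_join: "card (edges G) = (n choose 2) - ((n - k) choose 2)"
    and gn_iso_join_le: "gn G \<le> real k"
proof -
  obtain I where n: "card (verts G) = n" and I: "I \<subseteq> verts G" "card I = n - k"
    and E: "edges G = {e. e \<subseteq> verts G \<and> card e = 2 \<and> \<not> e \<subseteq> I}"
    using iso iso_join_complete_edgeless_iff[OF G kn] by blast
  have finI: "finite I" using I G by (auto simp: simple_graph_def intro: finite_subset)
  show "card (verts G) = n" by (rule n)
  have "{e. e \<subseteq> verts G \<and> card e = 2 \<and> e \<notin> edges G} = {e. e \<subseteq> I \<and> card e = 2}"
    using I(1) by (auto simp: E)
  then show "card (edges G) = (n choose 2) - ((n - k) choose 2)"
    using card_edges_complement[OF G] n_subsets[OF finI, of 2] n I(2) by simp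
  have "gn G \<le> real (card (verts G - I))"
    by (rule gn_le_card_diff_independent[OF G I(1)]) (auto simp: E)
  then show "gn G \<le> real k" using I n kn finI by (simp add: card_Diff_subset)
qed

text \<open>The join lives on a sum type, whereas the extremal family ranges over graphs on natural
  numbers; a copy of that type is needed to attain the maximum. Its edgeless part is
  \<open>{..<n - k}\<close>.\<close>

lemma iso_join_complete_edgeless_exists:
  assumes "k \<le> n"
  obtains G :: "nat ugraph" where "simple_graph G"
    "G \<simeq>\<^sub>g graph_join (complete_graph k) (edgeless_graph (n - k))"
proof
  let ?G = "\<lparr>verts = {..<n}, edges = {e. e \<subseteq> {..<n} \<and> card e = 2 \<and> \<not> e \<subseteq> {..<n - k}}\<rparr>"
  show G: "simple_graph ?G" by (simp add: simple_graph_def)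
  show "?G \<simeq>\<^sub>g graph_join (complete_graph k) (edgeless_graph (n - k))"
    unfolding iso_join_complete_edgeless_iff[OF G assms]
    by (auto intro!: exI[of _ "{..<n - k}"])
qed

theorem theorem3p2:
  fixes a :: real and n k :: nat
  assumes "a > 0"
    and "int n > \<lceil>a\<rceil>"
    and "int k = \<lceil>a\<rceil> - 1"
  shows "Ex_gn n a =
           {G. simple_graph G \<and> G \<simeq>\<^sub>g graph_join (complete_graph k) (edgeless_graph (n - k))}
         \<and> ex_gn n a = (n choose 2) - ((n - k) choose 2)"
proof -
  let ?iso = "\<lambda>G :: nat ugraph. G \<simeq>\<^sub>g graph_join (complete_graph k) (edgeless_graph (n - k))"
  let ?e = "(n choose 2) - ((n - k) choose 2)"
  have kn: "k + 2 \<le> n" using assms by linarith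
  \<comment> \<open>The lower bound admits the join, whose guessing number is at most
    \<open>k\<close>; the upper bound turns \<open>gn G < a\<close> into
    \<open>gn G < real k + 1\<close>.\<close>
  have ka: "real k < a" "a \<le> real k + 1" using assms(3) by linarith+
  have iso: "G \<in> gn_free_graphs n a \<and> card (edges G) = ?e" if "simple_graph G" "?iso G" for G
    using that kn ka card_verts_iso_join[of G k n] card_edges_iso_join[of G k n]
      gn_iso_join_le[of G k n] by (simp add: gn_free_graphs_def)
  have extremal: "?iso G" if "G \<in> gn_free_graphs n a" "card (edges G) \<ge> ?e" for G
    using that kn ka gn_lt_many_edges[of G n k] by (simp add: gn_free_graphs_def)
  \<comment> \<open>A graph with more than \<open>?e\<close> edges would be isomorphic to the join
    by \<open>extremal\<close>, and would then have exactly \<open>?e\<close> edges.\<close>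
  have le: "card (edges G) \<le> ?e" if G: "G \<in> gn_free_graphs n a" for G
    using iso[of G] extremal[OF G] G by (fastforce simp: gn_free_graphs_def)
  obtain G0 :: "nat ugraph" where "simple_graph G0" "?iso G0"
    using iso_join_complete_edgeless_exists[of k n] kn by auto
  with iso have G0: "G0 \<in> gn_free_graphs n a" "card (edges G0) = ?e" by auto
  have ex: "ex_gn n a = ?e"
    unfolding ex_gn_def
  proof (rule Max_eqI)
    show "finite ((\<lambda>G. card (edges G)) ` gn_free_graphs n a)"
      by (rule finite_subset[of _ "{..?e}"]) (use le in auto)
  qed (use le G0 in \<open>auto simp: image_iff intro!: bexI[of _ G0]\<close>)
  moreover have "Ex_gn n a = {G. simple_graph G \<and> ?iso G}"
  proof (intro set_eqI iffI)
    fix G assume "G \<in> Ex_gn n a"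
    then have "G \<in> gn_free_graphs n a" "card (edges G) = ?e" by (simp_all add: Ex_gn_def ex)
    then show "G \<in> {G. simple_graph G \<and> ?iso G}"
      using extremal[of G] by (simp add: gn_free_graphs_def)
  next
    fix G assume "G \<in> {G. simple_graph G \<and> ?iso G}"
    then show "G \<in> Ex_gn n a" using iso[of G] by (simp add: Ex_gn_def ex)
  qed
  ultimately show ?thesis by blast
qed

end
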